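(* For all $\lambda\in\Omega_0$, the functions $v_0(\lambda,x)$, $v_0'(\lambda,x)$, $v_0''(\lambda,x)$ of $x$ (primes denote $d/dx$) belong to the space $L^2(\mathbb{R}_+)$.
   Context: Setting: $m:\mathbb{R}\to\mathbb{R}$ is a measurable function having limits $m_\pm=\lim_{x\to\pm\infty}m(x)$ with $0<m_\pm<\infty$, and there is $a>0$ with $\int_{\mathbb{R}_\pm}|m(x)-m_\pm|^2e^{2a|x|}dx<\infty$. Put $n_+=m_+^{1/3}>0$, $z_+=\lambda n_+$. Let $\zeta_0=1$, $\zeta_1=\frac12(-1+i\sqrt3)$, $\zeta_2=\frac12(-1-i\sqrt3)$ and $s_2(z)=\frac13\left(e^{\zeta_0z}+\zeta_1^{-2}e^{\zeta_1z}+\zeta_2^{-2}e^{\zeta_2z}\right)$. The sector is $\Omega_0=\{\alpha+i\beta:\ \alpha,\beta\in\mathbb{R},\ |\alpha|<\sqrt3\,\beta\}$. For $\lambda\in\Omega_0$ the Jost solution at $+\infty$ of $iy'''(x)=m(x)\lambda^3y(x)$ is $v_0(\lambda,x)=e^{iz_+x}\psi_0(\lambda,x)$, where $\psi_0$ is the solution, given by the convergent Neumann series, of $$\psi_0(\lambda,x)=1-iz_+\int_x^\infty e^{iz_+(t-x)}s_2(iz_+(x-t))\left(\frac{m(t)}{m_+}-1\right)\psi_0(\lambda,t)dt .$$ *)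

theory Defs
  imports "HOL-Analysis.Analysis"
begin

definition zeta0 :: complex where "zeta0 = 1"
definition zeta1 :: complex where "zeta1 = (- 1 + \<i> * complex_of_real (sqrt 3)) / 2"
definition zeta2 :: complex where "zeta2 = (- 1 - \<i> * complex_of_real (sqrt 3)) / 2"

definition s2 :: "complex \<Rightarrow> complex" where
  "s2 z = (1/3) * (exp (zeta0 * z) + zeta1 powi (-2) * exp (zeta1 * z)
                                   + zeta2 powi (-2) * exp (zeta2 * z))"

definition Omega0 :: "complex set" where
  "Omega0 = {Complex \<alpha> \<beta> | \<alpha> \<beta>. \<bar>\<alpha>\<bar> < sqrt 3 * \<beta>}"

definition n_plus :: "real \<Rightarrow> real" where
  "n_plus mp = mp powr (1/3)"

definition z_plus :: "real \<Rightarrow> complex \<Rightarrow> complex" where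
  "z_plus mp lam = lam * complex_of_real (n_plus mp)"

(* The integral equation for psi_0 reads  psi_0 = 1 + jost_op m mp lam psi_0.
   The coefficient m is only Lebesgue measurable, so the integral is taken with respect to
   the completed measure; with lborel it could silently be the default value 0. *)
definition jost_op ::
  "(real \<Rightarrow> real) \<Rightarrow> real \<Rightarrow> complex \<Rightarrow> (real \<Rightarrow> complex) \<Rightarrow> real \<Rightarrow> complex" where
  "jost_op m mp lam f x =
     - \<i> * z_plus mp lam *
       (LINT t:{x..}|lebesgue.
          exp (\<i> * z_plus mp lam * complex_of_real (t - x))
          * s2 (\<i> * z_plus mp lam * complex_of_real (x - t))
          * complex_of_real (m t / mp - 1) * f t)"

(* The Neumann series  1 + T 1 + T (T 1) + ...  with T = jost_op m mp lam, which under the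
   standing assumptions converges pointwise for lam in Omega0 and solves  psi = 1 + T psi. *)
definition jost_psi :: "(real \<Rightarrow> real) \<Rightarrow> real \<Rightarrow> complex \<Rightarrow> real \<Rightarrow> complex" where
  "jost_psi m mp lam x = (\<Sum>k. (jost_op m mp lam ^^ k) (\<lambda>_. 1) x)"

definition jost_v :: "(real \<Rightarrow> real) \<Rightarrow> real \<Rightarrow> complex \<Rightarrow> real \<Rightarrow> complex" where
  "jost_v m mp lam x = exp (\<i> * z_plus mp lam * complex_of_real x) * jost_psi m mp lam x"

(* The constant deriv is not applicable to functions of type real => complex.  Note that ddx f x
   is meaningful only if f is differentiable at x. *)
definition ddx :: "(real \<Rightarrow> complex) \<Rightarrow> real \<Rightarrow> complex" where
  "ddx f x = vector_derivative f (at x)"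

definition in_L2_Rplus :: "(real \<Rightarrow> complex) \<Rightarrow> bool" where
  "in_L2_Rplus f \<longleftrightarrow>
     set_borel_measurable lebesgue {0..} f \<and>
     set_integrable lebesgue {0..} (\<lambda>x. (norm (f x))\<^sup>2)"

end

theory Submission imports Defs begin

text \<open>Put \<open>q = m / m\<^sub>+ - 1\<close> and \<open>z = z\<^sub>+\<close>. Since \<open>q(t)\<^sup>2 exp (2at)\<close> is integrable over the whole line, the
  Volterra operator of the integral equation is a contraction with factor \<open>1/2\<close> in the sup norm
  weighted by \<open>exp (c exp (-2ax))\<close> for large \<open>c\<close>; hence the Neumann series converges everywhere and
  is bounded on half-lines. The kernel is \<open>k(t - x)\<close> with
  \<open>k(u) = -(iz/3) (1 + \<zeta>\<^sub>1 exp (w\<^sub>1 u) + \<zeta>\<^sub>2 exp (w\<^sub>2 u))\<close> and \<open>w\<^sub>j = iz(1 - \<zeta>\<^sub>j)\<close>. For \<open>\<lambda> \<in> \<Omega>\<^sub>0\<close> it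
  is bounded on the half-line, and \<open>k(0) = k'(0) = 0\<close>. So \<open>\<psi>\<^sub>0\<close> can be differentiated twice under the
  integral at every point, \<open>\<psi>\<^sub>0\<close> and both derivatives are continuous and bounded on the half-line,
  and the factor \<open>exp (izx)\<close> decays exponentially.\<close>

section \<open>Integrals over a half-line with a translated kernel\<close>

text \<open>In the application \<open>h\<close> is the kernel or one of its derivatives and
  \<open>g\<close> is the coefficient times the solution. The variable \<open>x\<close> then enters
  only through \<open>h\<close> and the lower limit, so \<open>g\<close> is never
  differentiated.\<close>

definition tail_conv :: "(real \<Rightarrow> complex) \<Rightarrow> (real \<Rightarrow> complex) \<Rightarrow> real \<Rightarrow> complex" where
  "tail_conv h g x = (LINT t:{x..}|lebesgue. h (t - x) * g t)"

lemma continuous_borel_measurable_lebesgue: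
  fixes f :: "real \<Rightarrow> 'a::topological_space"
  assumes "continuous_on UNIV f"
  shows "f \<in> borel_measurable lebesgue"
  using borel_measurable_continuous_onI[OF assms] by (simp add: measurable_completion)

lemma translate_measurable:
  assumes "continuous_on UNIV (h :: real \<Rightarrow> complex)"
  shows "(\<lambda>t. h (t - x)) \<in> borel_measurable lebesgue"
  by (intro continuous_borel_measurable_lebesgue continuous_on_compose2[OF assms]) (auto intro!: continuous_intros)

text \<open>On the domain of integration \<open>t - x\<close> is nonnegative, so a bound on
  \<open>h\<close> over the half-line suffices. The exponentials of the kernel may grow on the other
  side.\<close>

lemma set_integrable_tail_conv:
  fixes h g :: "real \<Rightarrow> complex"
  assumes h: "continuous_on UNIV h" and hB: "\<And>u. 0 \<le> u \<Longrightarrow> norm (h u) \<le> B"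
    and g: "set_integrable lebesgue {x..} g"
  shows "set_integrable lebesgue {x..} (\<lambda>t. h (t - x) * g t)"
proof (rule set_integrable_bound)
  show "set_integrable lebesgue {x..} (\<lambda>t. complex_of_real B * g t)"
    using g by simp
  have "(\<lambda>t. indicator {x..} t *\<^sub>R g t) \<in> borel_measurable lebesgue"
    using g unfolding set_integrable_def by (rule borel_measurable_integrable)
  then have "(\<lambda>t. h (t - x) * (indicator {x..} t *\<^sub>R g t)) \<in> borel_measurable lebesgue"
    by (intro borel_measurable_times translate_measurable h)
  then show "set_borel_measurable lebesgue {x..} (\<lambda>t. h (t - x) * g t)"
    unfolding set_borel_measurable_def by (simp add: mult.commute)
  have "0 \<le> B" using hB[of 0] norm_ge_zero[of "h 0"] by linarith
  then show "AE t in lebesgue. t \<in> {x..} \<longrightarrow> norm (h (t - x) * g t) \<le> norm (complex_of_real B * g t)"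
    using hB by (auto simp: norm_mult intro!: mult_right_mono)
qed

lemma norm_tail_conv_le:
  fixes h g :: "real \<Rightarrow> complex"
  assumes h: "continuous_on UNIV h" and hB: "\<And>u. 0 \<le> u \<Longrightarrow> norm (h u) \<le> B"
    and g: "set_integrable lebesgue {x..} g"
  shows "norm (tail_conv h g x) \<le> B * (LINT t:{x..}|lebesgue. norm (g t))"
proof -
  have i: "set_integrable lebesgue {x..} (\<lambda>t. norm (g t))"
    using g set_integrable_norm by blast
  have "norm (tail_conv h g x) \<le> (LINT t:{x..}|lebesgue. norm (h (t - x) * g t))"
    unfolding tail_conv_def by (rule set_integral_norm_bound) (rule set_integrable_tail_conv[OF assms])
  also have "\<dots> \<le> (LINT t:{x..}|lebesgue. B * norm (g t))"
    using set_integrable_norm[OF set_integrable_tail_conv[OF assms]] i hB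
    by (intro set_integral_mono) (auto simp: norm_mult intro!: mult_right_mono)
  finally show ?thesis by simp
qed

text \<open>The tail \<open>{y..}\<close> contains every later tail, so its integral gives one
  constant for all of them.\<close>

lemma norm_tail_conv_bounded:
  fixes h g :: "real \<Rightarrow> complex"
  assumes h: "continuous_on UNIV h" and hB: "\<And>u. 0 \<le> u \<Longrightarrow> norm (h u) \<le> B"
    and g: "\<And>x. set_integrable lebesgue {x..} g"
  shows "\<exists>C. \<forall>x\<ge>y. norm (tail_conv h g x) \<le> C"
proof (intro exI allI impI)
  fix x assume "y \<le> x"
  have B: "0 \<le> B" using hB[of 0] norm_ge_zero[of "h 0"] by linarith
  have i: "set_integrable lebesgue {x..} (\<lambda>t. norm (g t))" for x
    using g set_integrable_norm by blast
  have "norm (tail_conv h g x) \<le> B * (LINT t:{x..}|lebesgue. norm (g t))"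
    by (rule norm_tail_conv_le[OF h hB g])
  also have "\<dots> \<le> B * (LINT t:{y..}|lebesgue. norm (g t))"
    using i[of x] i[of y] \<open>y \<le> x\<close> B unfolding set_lebesgue_integral_def set_integrable_def
    by (intro mult_left_mono integral_mono) (auto simp: indicator_def)
  finally show "norm (tail_conv h g x) \<le> B * (LINT t:{y..}|lebesgue. norm (g t))" .
qed

lemma AE_lebesgue_neq: "AE t in lebesgue. t \<noteq> (c::real)"
  by (intro AE_completion AE_lborel_singleton)

text \<open>Dominated convergence along sequences. The indicator of the moving half-line converges
  at every \<open>t\<close> except \<open>t = x\<close>, and a single point is null.\<close>

lemma isCont_tail_conv:
  fixes h g :: "real \<Rightarrow> complex"
  assumes h: "continuous_on UNIV h" and hB: "\<And>u. 0 \<le> u \<Longrightarrow> norm (h u) \<le> B"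
    and g: "\<And>x. set_integrable lebesgue {x..} g"
  shows "isCont (tail_conv h g) x"
proof -
  have B: "0 \<le> B" using hB[of 0] norm_ge_zero[of "h 0"] by linarith
  \<comment> \<open>Confining the sequence to a unit neighbourhood keeps every \<open>X i\<close>
    above \<open>x - 1\<close>, so one majorant supported on \<open>{x-1..}\<close> serves all
    terms.\<close>
  have "(tail_conv h g \<longlongrightarrow> tail_conv h g x) (at x within {x-1<..<x+1})"
    unfolding tendsto_at_iff_sequentially o_def
  proof (intro allI impI)
    fix X :: "nat \<Rightarrow> real"
    assume X: "\<forall>i. X i \<in> {x-1<..<x+1} - {x}" and lim: "X \<longlonglongrightarrow> x"
    show "(\<lambda>i. tail_conv h g (X i)) \<longlonglongrightarrow> tail_conv h g x"
      unfolding tail_conv_def set_lebesgue_integral_def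
    proof (rule integral_dominated_convergence)
      show "integrable lebesgue (\<lambda>t. B * norm (indicator {x-1..} t *\<^sub>R g t))"
        using g[of "x-1"] unfolding set_integrable_def
        by (intro integrable_mult_right integrable_norm)
      show "(\<lambda>t. indicator {x..} t *\<^sub>R (h (t - x) * g t)) \<in> borel_measurable lebesgue"
        using set_integrable_tail_conv[OF h hB g] unfolding set_integrable_def by auto
      show "(\<lambda>t. indicator {X i..} t *\<^sub>R (h (t - X i) * g t)) \<in> borel_measurable lebesgue" for i
        using set_integrable_tail_conv[OF h hB g] unfolding set_integrable_def by auto
      show "AE t in lebesgue. norm (indicator {X i..} t *\<^sub>R (h (t - X i) * g t))
              \<le> B * norm (indicator {x-1..} t *\<^sub>R g t)" for i
      proof (rule AE_I2)
        fix t
        have "x - 1 < X i" using X by auto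
        then show "norm (indicator {X i..} t *\<^sub>R (h (t - X i) * g t)) \<le> B * norm (indicator {x-1..} t *\<^sub>R g t)"
          using hB[of "t - X i"] B by (auto simp: indicator_def norm_mult intro!: mult_right_mono)
      qed
      show "AE t in lebesgue. (\<lambda>i. indicator {X i..} t *\<^sub>R (h (t - X i) * g t))
              \<longlonglongrightarrow> indicator {x..} t *\<^sub>R (h (t - x) * g t)"
        using AE_lebesgue_neq[of x]
      proof eventually_elim
        fix t assume "t \<noteq> x"
        have "(\<lambda>i. indicator {X i..} t :: real) \<longlonglongrightarrow> indicator {x..} t"
        proof (rule tendsto_eventually)
          consider "t < x" | "x < t" using \<open>t \<noteq> x\<close> by linarith
          then show "\<forall>\<^sub>F i in sequentially. (indicator {X i..} t :: real) = indicator {x..} t"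
          proof cases
            case 1
            from order_tendstoD(1)[OF lim this] show ?thesis
              by eventually_elim (use 1 in \<open>auto simp: indicator_def\<close>)
          next
            case 2
            from order_tendstoD(2)[OF lim this] show ?thesis
              by eventually_elim (use 2 in \<open>auto simp: indicator_def\<close>)
          qed
        qed
        moreover have "isCont h (t - x)" using h by (simp add: continuous_on_eq_continuous_at)
        then have "(\<lambda>i. h (t - X i)) \<longlonglongrightarrow> h (t - x)"
          by (rule isCont_tendsto_compose) (intro tendsto_intros lim)
        ultimately show "(\<lambda>i. indicator {X i..} t *\<^sub>R (h (t - X i) * g t))
              \<longlonglongrightarrow> indicator {x..} t *\<^sub>R (h (t - x) * g t)"
          by (intro tendsto_intros)
      qed
    qed
  qed
  moreover have "at x within {x-1<..<x+1} = at x"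
    by (rule at_within_open) auto
  ultimately show ?thesis by (simp add: isCont_def)
qed

lemma continuous_on_tail_conv:
  assumes "continuous_on UNIV h" "\<And>u. 0 \<le> u \<Longrightarrow> norm (h u) \<le> B"
    and "\<And>x. set_integrable lebesgue {x..} g"
  shows "continuous_on UNIV (tail_conv h g)"
  using isCont_tail_conv[OF assms] by (simp add: continuous_at_imp_continuous_on)

text \<open>Turns differentiability into a limit of difference quotients, the form to which
  dominated convergence along sequences applies.\<close>

lemma has_vector_derivative_at_iff_quotient:
  "(f has_vector_derivative D) (at x) \<longleftrightarrow> ((\<lambda>y. (1 / (y - x)) *\<^sub>R (f y - f x)) \<longlongrightarrow> D) (at x)"
proof -
  have "(f has_vector_derivative D) (at x) \<longleftrightarrow>
      ((\<lambda>y. norm (f y - f x - (y - x) *\<^sub>R D) / norm (y - x)) \<longlongrightarrow> 0) (at x)"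
    unfolding has_vector_derivative_def has_derivative_iff_norm
    by (simp add: bounded_linear_scaleR_left)
  also have "\<dots> \<longleftrightarrow> ((\<lambda>y. norm ((1 / (y - x)) *\<^sub>R (f y - f x) - D)) \<longlongrightarrow> 0) (at x)"
  proof (rule filterlim_cong[OF refl refl])
    show "\<forall>\<^sub>F y in at x. norm (f y - f x - (y - x) *\<^sub>R D) / norm (y - x)
            = norm ((1 / (y - x)) *\<^sub>R (f y - f x) - D)"
    proof (rule eventually_at_filter[THEN iffD2], rule always_eventually, intro allI impI)
      fix y assume "y \<noteq> x"
      then have "(1 / (y - x)) *\<^sub>R (f y - f x) - D = (1 / (y - x)) *\<^sub>R (f y - f x - (y - x) *\<^sub>R D)"
        by (simp add: scaleR_diff_right)
      then show "norm (f y - f x - (y - x) *\<^sub>R D) / norm (y - x) = norm ((1 / (y - x)) *\<^sub>R (f y - f x) - D)"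
        by simp
    qed
  qed
  also have "\<dots> \<longleftrightarrow> ((\<lambda>y. (1 / (y - x)) *\<^sub>R (f y - f x)) \<longlongrightarrow> D) (at x)"
    by (simp add: tendsto_norm_zero_iff LIM_zero_iff)
  finally show ?thesis .
qed

text \<open>Mean value inequality on the convex set \<open>{0..}\<close>, where the bound on the
  derivative is available. It provides the majorant for difference quotients under the
  integral.\<close>

lemma vector_derivative_bound_Lipschitz:
  fixes h h' :: "real \<Rightarrow> complex"
  assumes "\<And>u. (h has_vector_derivative h' u) (at u)" "\<And>u. 0 \<le> u \<Longrightarrow> norm (h' u) \<le> B"
    and "0 \<le> u" "0 \<le> v"
  shows "norm (h u - h v) \<le> B * \<bar>u - v\<bar>"
proof -
  have "norm (h u - h v) \<le> B * norm (u - v)"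
  proof (rule differentiable_bound[where S="{0..}" and f'="\<lambda>u s. s *\<^sub>R h' u"])
    fix s :: real assume "s \<in> {0..}"
    show "(h has_derivative (\<lambda>t. t *\<^sub>R h' s)) (at s within {0..})"
      using assms(1)[of s] unfolding has_vector_derivative_def by (rule has_derivative_at_withinI)
    show "onorm (\<lambda>t. t *\<^sub>R h' s) \<le> B"
      using assms(2)[of s] \<open>s \<in> {0..}\<close>
      by (intro onorm_le) (auto simp: mult.commute[of "\<bar>_\<bar>"] intro!: mult_right_mono)
  qed (use assms in auto)
  then show ?thesis by simp
qed

text \<open>The boundary term \<open>- h 0 * g x\<close> of the Leibniz rule vanishes because \<open>h 0 = 0\<close>; hence the
  derivative exists at every point although \<open>g\<close> is merely integrable.\<close>

lemma tail_conv_has_vector_derivative: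
  fixes h h' g :: "real \<Rightarrow> complex"
  assumes dh: "\<And>u. (h has_vector_derivative h' u) (at u)"
    and h'B: "\<And>u. 0 \<le> u \<Longrightarrow> norm (h' u) \<le> B"
    and h': "continuous_on UNIV h'"
    and hB: "\<And>u. 0 \<le> u \<Longrightarrow> norm (h u) \<le> B0"
    and h0: "h 0 = 0"
    and g: "\<And>x. set_integrable lebesgue {x..} g"
  shows "(tail_conv h g has_vector_derivative - tail_conv h' g x) (at x)"
proof -
  have h: "continuous_on UNIV h"
    using has_vector_derivative_continuous[OF dh] by (simp add: continuous_at_imp_continuous_on)
  note lip = vector_derivative_bound_Lipschitz[of h h' B, OF dh h'B]
  have B: "0 \<le> B" using h'B[of 0] norm_ge_zero[of "h' 0"] by linarith
  have int: "integrable lebesgue (\<lambda>t. indicator {y..} t *\<^sub>R (h (t - y) * g t))" for y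
    using set_integrable_tail_conv[OF h hB g] unfolding set_integrable_def .
  have int': "integrable lebesgue (\<lambda>t. indicator {y..} t *\<^sub>R (h' (t - y) * g t))" for y
    using set_integrable_tail_conv[OF h' h'B g] unfolding set_integrable_def .
  \<comment> \<open>The indicators stay inside the quotient, so the change of the lower limit and
    the change of the kernel are treated in a single limit.\<close>
  let ?q = "\<lambda>y t. (1 / (y - x)) *\<^sub>R (indicator {y..} t *\<^sub>R (h (t - y) * g t) - indicator {x..} t *\<^sub>R (h (t - x) * g t))"
  have "((\<lambda>y. (1 / (y - x)) *\<^sub>R (tail_conv h g y - tail_conv h g x)) \<longlongrightarrow> - tail_conv h' g x)
          (at x within {x-1<..<x+1})"
    unfolding tendsto_at_iff_sequentially o_def
  proof (intro allI impI)
    fix X :: "nat \<Rightarrow> real"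
    assume X: "\<forall>i. X i \<in> {x-1<..<x+1} - {x}" and lim: "X \<longlonglongrightarrow> x"
    have "(\<lambda>i. LINT t|lebesgue. ?q (X i) t) \<longlonglongrightarrow> (LINT t|lebesgue. - (indicator {x..} t *\<^sub>R (h' (t - x) * g t)))"
    proof (rule integral_dominated_convergence)
      show "integrable lebesgue (\<lambda>t. B * norm (indicator {x-1..} t *\<^sub>R g t))"
        using g[of "x-1"] unfolding set_integrable_def
        by (intro integrable_mult_right integrable_norm)
      show "(\<lambda>t. - (indicator {x..} t *\<^sub>R (h' (t - x) * g t))) \<in> borel_measurable lebesgue"
        by (intro borel_measurable_uminus borel_measurable_integrable int')
      show "?q (X i) \<in> borel_measurable lebesgue" for i
        by (intro borel_measurable_integrable integrable_scaleR_right Bochner_Integration.integrable_diff int)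
      show "AE t in lebesgue. norm (?q (X i) t) \<le> B * norm (indicator {x-1..} t *\<^sub>R g t)" for i
      proof (rule AE_I2)
        fix t
        define y where "y = X i"
        have y: "x - 1 < y" "y \<noteq> x" using X by (auto simp: y_def)
        define e where "e = indicator {y..} t *\<^sub>R h (t - y) - indicator {x..} t *\<^sub>R h (t - x)"
        have "norm e \<le> B * \<bar>y - x\<bar> * indicator {x-1..} t"
        proof -
          \<comment> \<open>Left of both endpoints \<open>e\<close> vanishes, and right of both the
            Lipschitz bound applies directly. Between them only one term survives; because
            \<open>h 0 = 0\<close>, comparison with the point \<open>0\<close> bounds it by
            \<open>B\<close> times the distance from \<open>t\<close> to the endpoint.\<close>
          consider "t < x" "t < y" | "x \<le> t" "y \<le> t" | "x \<le> t" "t < y" | "y \<le> t" "t < x" by linarith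
          then show ?thesis
          proof cases
            case 1 then show ?thesis using B by (auto simp: e_def)
          next
            case 2 then show ?thesis
              using lip[of "t - y" "t - x"] y by (auto simp: e_def abs_minus_commute)
          next
            case 3
            have "norm (h (t - x)) \<le> B * (t - x)" using lip[of "t - x" 0] h0 3 by simp
            also have "\<dots> \<le> B * \<bar>y - x\<bar>" using 3 B by (intro mult_left_mono) auto
            finally show ?thesis using 3 y by (auto simp: e_def)
          next
            case 4
            have "norm (h (t - y)) \<le> B * (t - y)" using lip[of "t - y" 0] h0 4 by simp
            also have "\<dots> \<le> B * \<bar>y - x\<bar>" using 4 B by (intro mult_left_mono) auto
            finally show ?thesis using 4 y by (auto simp: e_def)
          qed
        qed
        then have "norm e * norm (g t) \<le> B * \<bar>y - x\<bar> * indicator {x-1..} t * norm (g t)"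
          by (rule mult_right_mono) simp
        moreover have "?q y t = (1 / (y - x)) *\<^sub>R (e * g t)"
          by (simp add: e_def algebra_simps)
        ultimately show "norm (?q (X i) t) \<le> B * norm (indicator {x-1..} t *\<^sub>R g t)"
          using y by (simp add: norm_mult field_simps flip: y_def)
      qed
      show "AE t in lebesgue. (\<lambda>i. ?q (X i) t) \<longlonglongrightarrow> - (indicator {x..} t *\<^sub>R (h' (t - x) * g t))"
        using AE_lebesgue_neq[of x]
      proof eventually_elim
        fix t assume "t \<noteq> x"
        \<comment> \<open>For fixed \<open>t\<close> other than \<open>x\<close>, the points
          \<open>X i\<close> eventually lie on the same side of \<open>t\<close> as
          \<open>x\<close>, so both indicators agree from then on.\<close>
        then consider "t < x" | "x < t" by linarith
        then show "(\<lambda>i. ?q (X i) t) \<longlonglongrightarrow> - (indicator {x..} t *\<^sub>R (h' (t - x) * g t))"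
        proof cases
          case 1
          have "\<forall>\<^sub>F i in sequentially. ?q (X i) t = - (indicator {x..} t *\<^sub>R (h' (t - x) * g t))"
            using order_tendstoD(1)[OF lim 1] by eventually_elim (use 1 in auto)
          then show ?thesis by (rule tendsto_eventually)
        next
          case 2
          have "((\<lambda>y. h (t - y)) has_vector_derivative (-1) *\<^sub>R h' (t - x)) (at x)"
            using vector_diff_chain_at[of "\<lambda>y. t - y" "-1" x h "h' (t - x)", OF _ dh]
              has_vector_derivative_diff[OF has_vector_derivative_const has_vector_derivative_id, of t "at x"]
            by (simp add: o_def)
          then have "((\<lambda>y. (1 / (y - x)) *\<^sub>R (h (t - y) - h (t - x))) \<longlongrightarrow> - h' (t - x)) (at x)"
            by (simp add: has_vector_derivative_at_iff_quotient)
          then have "(\<lambda>i. (1 / (X i - x)) *\<^sub>R (h (t - X i) - h (t - x))) \<longlonglongrightarrow> - h' (t - x)"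
            unfolding tendsto_at_iff_sequentially o_def using X lim by auto
          then have "(\<lambda>i. (1 / (X i - x)) *\<^sub>R (h (t - X i) - h (t - x)) * g t) \<longlonglongrightarrow> - h' (t - x) * g t"
            by (intro tendsto_intros)
          moreover have "\<forall>\<^sub>F i in sequentially. (1 / (X i - x)) *\<^sub>R (h (t - X i) - h (t - x)) * g t = ?q (X i) t"
            using order_tendstoD(2)[OF lim 2]
            by eventually_elim (use 2 in \<open>auto simp: algebra_simps\<close>)
          ultimately have "(\<lambda>i. ?q (X i) t) \<longlonglongrightarrow> - h' (t - x) * g t"
            by (rule Lim_transform_eventually)
          then show ?thesis using 2 by simp
        qed
      qed
    qed
    moreover have "(LINT t|lebesgue. ?q y t) = (1 / (y - x)) *\<^sub>R (tail_conv h g y - tail_conv h g x)" for y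
      unfolding tail_conv_def set_lebesgue_integral_def
      by (simp only: integral_scaleR_right Bochner_Integration.integral_diff[OF int int])
    moreover have "(LINT t|lebesgue. - (indicator {x..} t *\<^sub>R (h' (t - x) * g t))) = - tail_conv h' g x"
      by (simp add: tail_conv_def set_lebesgue_integral_def)
    ultimately show "(\<lambda>i. (1 / (X i - x)) *\<^sub>R (tail_conv h g (X i) - tail_conv h g x)) \<longlonglongrightarrow> - tail_conv h' g x"
      by (simp only:)
  qed
  moreover have "at x within {x-1<..<x+1} = at x"
    by (rule at_within_open) auto
  ultimately show ?thesis by (simp add: has_vector_derivative_at_iff_quotient)
qed

section \<open>Neumann series of a contractive Volterra operator\<close>

text \<open>The last assumption is the contraction estimate in the sup norm weighted by
  \<open>W\<close>, uniformly in the lower limit \<open>x\<close>. The bound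
  \<open>1 \<le> W x\<close> puts the constant \<open>1\<close>, the first term of the series, into
  the unit ball of that norm.\<close>

locale volterra_contraction =
  fixes k q :: "real \<Rightarrow> complex" and W :: "real \<Rightarrow> real" and B :: real
  assumes k_cont: "continuous_on UNIV k"
    and k_bound: "\<And>u. 0 \<le> u \<Longrightarrow> norm (k u) \<le> B"
    and q_meas: "q \<in> borel_measurable lebesgue"
    and W_ge_1: "\<And>x. 1 \<le> W x"
    and qW_integrable: "\<And>x. set_integrable lebesgue {x..} (\<lambda>t. norm (q t) * W t)"
    and qW_le: "\<And>x. B * (LINT t:{x..}|lebesgue. norm (q t) * W t) \<le> W x / 2"
begin

definition T :: "(real \<Rightarrow> complex) \<Rightarrow> real \<Rightarrow> complex" where
  "T f = tail_conv k (\<lambda>t. q t * f t)"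

text \<open>The ball of radius \<open>C\<close> in the weighted sup norm. Measurability is included
  so that membership alone makes the integrals against \<open>q\<close> exist.\<close>

definition bounded_by :: "real \<Rightarrow> (real \<Rightarrow> complex) \<Rightarrow> bool" where
  "bounded_by C f \<longleftrightarrow> f \<in> borel_measurable lebesgue \<and> (\<forall>x. norm (f x) \<le> C * W x)"

lemma W_pos: "0 < W x"
  using W_ge_1[of x] by linarith

lemma B_nonneg: "0 \<le> B"
  using k_bound[of 0] norm_ge_zero[of "k 0"] by linarith

lemma q_integrable:
  assumes "bounded_by C f"
  shows "set_integrable lebesgue {x..} (\<lambda>t. q t * f t)"
proof (rule set_integrable_bound)
  have [measurable]: "f \<in> borel_measurable lebesgue" "q \<in> borel_measurable lebesgue"
    using assms q_meas by (auto simp: bounded_by_def)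
  show "set_integrable lebesgue {x..} (\<lambda>t. C * (norm (q t) * W t))"
    using qW_integrable by simp
  show "set_borel_measurable lebesgue {x..} (\<lambda>t. q t * f t)"
    unfolding set_borel_measurable_def
    by (intro borel_measurable_scaleR borel_measurable_indicator borel_measurable_times) auto
  show "AE t in lebesgue. t \<in> {x..} \<longrightarrow> norm (q t * f t) \<le> norm (C * (norm (q t) * W t))"
  proof (intro AE_I2 impI)
    fix t
    have "norm (q t) * norm (f t) \<le> norm (q t) * (C * W t)"
      using assms by (intro mult_left_mono) (auto simp: bounded_by_def)
    then show "norm (q t * f t) \<le> norm (C * (norm (q t) * W t))"
      by (simp add: norm_mult mult_ac)
  qed
qed

text \<open>The factor \<open>1/2\<close> comes from \<open>qW_le\<close>; measurability of the
  image comes from continuity of \<open>tail_conv\<close>.\<close>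

lemma T_bounded_by:
  assumes "bounded_by C f"
  shows "bounded_by (C / 2) (T f)"
  unfolding bounded_by_def
proof (intro conjI allI)
  note i = q_integrable[OF assms]
  show "T f \<in> borel_measurable lebesgue"
    unfolding T_def
    by (intro continuous_borel_measurable_lebesgue continuous_on_tail_conv[OF k_cont k_bound i])
  fix x
  have "0 \<le> C * W 0" using assms norm_ge_zero[of "f 0"] unfolding bounded_by_def by (meson order_trans)
  then have C: "0 \<le> C" using W_pos[of 0] by (simp add: zero_le_mult_iff)
  have "(LINT t:{x..}|lebesgue. norm (q t * f t)) \<le> (LINT t:{x..}|lebesgue. C * (norm (q t) * W t))"
  proof (rule set_integral_mono)
    show "set_integrable lebesgue {x..} (\<lambda>t. norm (q t * f t))"
      by (rule set_integrable_norm[OF i])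
    show "set_integrable lebesgue {x..} (\<lambda>t. C * (norm (q t) * W t))"
      using qW_integrable by simp
    fix t
    have "norm (q t) * norm (f t) \<le> norm (q t) * (C * W t)"
      using assms by (intro mult_left_mono) (auto simp: bounded_by_def)
    then show "norm (q t * f t) \<le> C * (norm (q t) * W t)"
      by (simp add: norm_mult mult_ac)
  qed
  then have "B * (LINT t:{x..}|lebesgue. norm (q t * f t)) \<le> C * (B * (LINT t:{x..}|lebesgue. norm (q t) * W t))"
    using B_nonneg mult_left_mono by (fastforce simp: mult_ac)
  also have "\<dots> \<le> C * (W x / 2)"
    using C qW_le by (intro mult_left_mono)
  finally show "norm (T f x) \<le> C / 2 * W x"
    using norm_tail_conv_le[OF k_cont k_bound i, of x] unfolding T_def by simp
qed

lemma T_diff: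
  assumes "bounded_by C f" "bounded_by D g"
  shows "T (\<lambda>t. f t - g t) x = T f x - T g x"
proof -
  have "(\<lambda>t. k (t - x) * (q t * (f t - g t))) = (\<lambda>t. k (t - x) * (q t * f t) - k (t - x) * (q t * g t))"
    by (simp add: algebra_simps)
  then show ?thesis
    unfolding T_def tail_conv_def
    using set_integrable_tail_conv[OF k_cont k_bound q_integrable[OF assms(1)]]
      set_integrable_tail_conv[OF k_cont k_bound q_integrable[OF assms(2)]]
    by (simp add: set_integral_diff)
qed

lemma T_add:
  assumes "bounded_by C f" "bounded_by D g"
  shows "T (\<lambda>t. f t + g t) x = T f x + T g x"
proof -
  have "(\<lambda>t. k (t - x) * (q t * (f t + g t))) = (\<lambda>t. k (t - x) * (q t * f t) + k (t - x) * (q t * g t))"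
    by (simp add: algebra_simps)
  then show ?thesis
    unfolding T_def tail_conv_def
    using set_integrable_tail_conv[OF k_cont k_bound q_integrable[OF assms(1)]]
      set_integrable_tail_conv[OF k_cont k_bound q_integrable[OF assms(2)]]
    by (simp add: set_integral_add)
qed

definition iter :: "nat \<Rightarrow> real \<Rightarrow> complex" where
  "iter n = (T ^^ n) (\<lambda>_. 1)"

definition neumann :: "real \<Rightarrow> complex" where
  "neumann x = (\<Sum>n. iter n x)"

lemma iter_bounded_by: "bounded_by ((1/2) ^ n) (iter n)"
proof (induction n)
  case 0
  show ?case using W_ge_1 by (simp add: iter_def bounded_by_def)
next
  case (Suc n)
  from T_bounded_by[OF this] show ?case by (simp add: iter_def)
qed

lemma norm_iter_le: "norm (iter n x) \<le> (1/2) ^ n * W x"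
  using iter_bounded_by[of n] by (simp add: bounded_by_def)

lemma geometric_tail_sums: "(\<lambda>i. (1/2) ^ (i + n) * W x) sums (2 * (1/2) ^ n * W x)"
  using sums_mult2[OF sums_mult2[OF geometric_sums[of "1/2 :: real"]], of "(1/2) ^ n" "W x"]
  by (simp add: power_add)

lemma summable_norm_iter: "summable (\<lambda>n. norm (iter n x))"
  by (rule summable_comparison_test'[OF sums_summable[OF geometric_tail_sums[of 0 x]], of 0])
    (simp add: norm_iter_le)

lemma summable_iter: "summable (\<lambda>n. iter n x)"
  using summable_norm_iter by (rule summable_norm_cancel)

text \<open>Comparison with a geometric tail. The case \<open>n = 0\<close> bounds the series
  itself; the general case is convergence in the weighted norm, which lets \<open>T\<close> pass to
  the limit.\<close>

lemma neumann_remainder: "norm (neumann x - (\<Sum>i<n. iter i x)) \<le> 2 * (1/2) ^ n * W x"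
proof -
  have "neumann x - (\<Sum>i<n. iter i x) = (\<Sum>i. iter (i + n) x)"
    unfolding neumann_def using suminf_split_initial_segment[OF summable_iter, of x n] by simp
  also have "norm \<dots> \<le> (\<Sum>i. (1/2) ^ (i + n) * W x)"
    by (rule norm_suminf_le) (use norm_iter_le geometric_tail_sums[of n x] in \<open>auto simp: sums_iff\<close>)
  also have "\<dots> = 2 * (1/2) ^ n * W x"
    using geometric_tail_sums[of n x] by (simp add: sums_iff)
  finally show ?thesis .
qed

lemma partial_sum_measurable: "(\<lambda>x. \<Sum>i<n. iter i x) \<in> borel_measurable lebesgue"
  using iter_bounded_by by (intro borel_measurable_sum) (auto simp: bounded_by_def)

lemma neumann_measurable: "neumann \<in> borel_measurable lebesgue"
proof (rule borel_measurable_LIMSEQ_metric[OF partial_sum_measurable])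
  show "(\<lambda>n. \<Sum>i<n. iter i x) \<longlonglongrightarrow> neumann x" for x
    unfolding neumann_def by (rule summable_LIMSEQ[OF summable_iter])
qed

lemma neumann_bounded_by: "bounded_by 2 neumann"
  using neumann_remainder[of _ 0] neumann_measurable by (simp add: bounded_by_def)

text \<open>The constant is crude: \<open>2\<close> from the series and at most \<open>2\<close>
  from the remainder. It serves to make the additivity of \<open>T\<close> applicable to partial
  sums.\<close>

lemma partial_sum_bounded_by: "bounded_by 4 (\<lambda>x. \<Sum>i<n. iter i x)"
  unfolding bounded_by_def
proof (intro conjI partial_sum_measurable allI)
  fix x
  have "norm (\<Sum>i<n. iter i x) \<le> norm (neumann x) + norm (neumann x - (\<Sum>i<n. iter i x))"
    by (metis norm_minus_commute norm_triangle_sub)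
  also have "\<dots> \<le> 2 * W x + 2 * (1/2) ^ n * W x"
    using neumann_bounded_by neumann_remainder by (intro add_mono) (auto simp: bounded_by_def)
  also have "2 * (1/2) ^ n * W x \<le> 2 * W x"
    using W_pos[of x] by (intro mult_right_mono) (auto simp: power_le_one)
  finally show "norm (\<Sum>i<n. iter i x) \<le> 4 * W x" by simp
qed

lemma T_partial_sum: "T (\<lambda>x. \<Sum>i<n. iter i x) x = (\<Sum>i<n. iter (Suc i) x)"
proof (induction n)
  case 0
  then show ?case by (simp add: T_def tail_conv_def)
next
  case (Suc n)
  then show ?case
    using T_add[OF partial_sum_bounded_by iter_bounded_by, of n n x] by (simp add: iter_def)
qed

text \<open>Applied to the remainder after \<open>n\<close> terms, \<open>T\<close> gives at most
  \<open>(1/2) ^ n * W x\<close>. Hence the series without its head converges to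
  \<open>T neumann x\<close>, and the head is the constant \<open>1\<close>.\<close>

lemma neumann_eq: "neumann x = 1 + T neumann x"
proof -
  have "(\<lambda>n. \<Sum>i<n. iter (Suc i) x) \<longlonglongrightarrow> T neumann x"
  proof (rule LIMSEQ_I)
    fix r :: real assume "r > 0"
    have bd: "norm ((\<Sum>i<n. iter (Suc i) x) - T neumann x) \<le> (1/2) ^ n * W x" for n
    proof -
      have "bounded_by (2 * (1/2) ^ n) (\<lambda>x. neumann x - (\<Sum>i<n. iter i x))"
        unfolding bounded_by_def
        using neumann_remainder neumann_measurable partial_sum_measurable by auto
      from T_bounded_by[OF this]
      have "norm (T (\<lambda>x. neumann x - (\<Sum>i<n. iter i x)) x) \<le> (1/2) ^ n * W x"
        by (simp add: bounded_by_def)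
      then show ?thesis
        by (simp add: T_diff[OF neumann_bounded_by partial_sum_bounded_by] T_partial_sum norm_minus_commute)
    qed
    have "(\<lambda>n. (1/2) ^ n * W x) \<longlonglongrightarrow> 0 * W x"
      by (intro tendsto_intros LIMSEQ_realpow_zero) auto
    then have "\<forall>\<^sub>F n in sequentially. (1/2) ^ n * W x < r"
      using \<open>r > 0\<close> by (simp add: order_tendstoD)
    then show "\<exists>no. \<forall>n\<ge>no. norm ((\<Sum>i<n. iter (Suc i) x) - T neumann x) < r"
      unfolding eventually_sequentially using bd by (meson le_less_trans)
  qed
  then have "(\<lambda>n. iter (Suc n) x) sums T neumann x" by (simp add: sums_def)
  then have "(\<Sum>n. iter (Suc n) x) = T neumann x" by (simp add: sums_iff)
  then show ?thesis
    unfolding neumann_def using suminf_split_head[OF summable_iter, of x] by (simp add: iter_def)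
qed

end

section \<open>A weight for exponentially decaying coefficients\<close>

text \<open>Chosen so that the derivative of the squared weight is exactly
  \<open>- 4 * a * c\<close> times \<open>(weight a c t)\<^sup>2 * exp (- 2 * a * t)\<close>; the
  large parameter \<open>c\<close> thereby ends up in a denominator.\<close>

definition weight :: "real \<Rightarrow> real \<Rightarrow> real \<Rightarrow> real" where
  "weight a c x = exp (c * exp (- 2 * a * x))"

lemma weight_ge_1: "0 \<le> c \<Longrightarrow> 1 \<le> weight a c x"
  by (simp add: weight_def)

text \<open>The integrand is nonnegative with an explicit antiderivative, so the fundamental theorem
  for nonnegative integrals yields integrability and value together. Dropping the negative
  contribution from infinity leaves the bound.\<close>

lemma weight_square_tail:
  assumes "0 < a" "0 < c"
  shows "set_integrable lebesgue {x..} (\<lambda>t. (weight a c t)\<^sup>2 * exp (- 2 * a * t))"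
    and "(LINT t:{x..}|lebesgue. (weight a c t)\<^sup>2 * exp (- 2 * a * t)) \<le> (weight a c x)\<^sup>2 / (4 * a * c)"
proof -
  define f where "f t = (weight a c t)\<^sup>2 * exp (- 2 * a * t)" for t
  define F where "F t = - (weight a c t)\<^sup>2 / (4 * a * c)" for t
  have fc: "continuous_on UNIV f"
    unfolding f_def weight_def by (intro continuous_intros)
  have F: "DERIV F t :> f t" for t
    unfolding F_def f_def weight_def using assms
    by (auto intro!: derivative_eq_intros simp: field_simps power2_eq_square)
  have "((\<lambda>t. exp (- 2 * a * t)) \<longlongrightarrow> 0) at_top"
    using assms
    by (intro filterlim_compose[OF exp_at_bot] filterlim_tendsto_neg_mult_at_bot[OF tendsto_const _ filterlim_ident]) auto
  then have "((\<lambda>t. - (exp (c * exp (- 2 * a * t)))\<^sup>2 / (4 * a * c)) \<longlongrightarrow> - (exp (c * 0))\<^sup>2 / (4 * a * c)) at_top"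
    using assms by (intro tendsto_intros) auto
  moreover have "F = (\<lambda>t. - (exp (c * exp (- 2 * a * t)))\<^sup>2 / (4 * a * c))"
    by (simp add: F_def weight_def fun_eq_iff)
  ultimately have lim: "(F \<longlongrightarrow> - 1 / (4 * a * c)) at_top"
    by simp
  have nn: "0 \<le> f t" for t by (simp add: f_def)
  have N: "(\<integral>\<^sup>+t. ennreal (f t) * indicator {x..} t \<partial>lborel) = ennreal (- 1 / (4 * a * c) - F x)"
    by (rule nn_integral_FTC_atLeast[OF borel_measurable_continuous_onI[OF fc] F nn lim])
  have eq: "(\<integral>\<^sup>+t. ennreal (indicator {x..} t *\<^sub>R f t) \<partial>lebesgue) = ennreal (- 1 / (4 * a * c) - F x)"
    unfolding nn_integral_completion N[symmetric]
    by (intro nn_integral_cong) (auto simp: indicator_def)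
  \<comment> \<open>This makes the value in \<open>eq\<close> nonnegative, so that
    \<open>ennreal\<close> does not truncate it to \<open>0\<close>.\<close>
  have Fx: "F x \<le> - 1 / (4 * a * c)"
    using assms weight_ge_1[of c a x] by (simp add: F_def divide_right_mono)
  have hb: "has_bochner_integral lebesgue (\<lambda>t. indicator {x..} t *\<^sub>R f t) (- 1 / (4 * a * c) - F x)"
  proof (rule has_bochner_integral_nn_integral[OF _ _ _ eq])
    show "(\<lambda>t. indicator {x..} t *\<^sub>R f t) \<in> borel_measurable lebesgue"
      using continuous_borel_measurable_lebesgue[OF fc]
      by (intro borel_measurable_scaleR borel_measurable_indicator) auto
  qed (use nn Fx in auto)
  then show "set_integrable lebesgue {x..} (\<lambda>t. (weight a c t)\<^sup>2 * exp (- 2 * a * t))"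
    unfolding set_integrable_def f_def[symmetric] by (rule integrable.intros)
  have "(LINT t:{x..}|lebesgue. f t) = - 1 / (4 * a * c) - F x"
    unfolding set_lebesgue_integral_def using hb by (rule has_bochner_integral_integral_eq)
  also have "\<dots> \<le> (weight a c x)\<^sup>2 / (4 * a * c)"
    using assms by (simp add: F_def)
  finally show "(LINT t:{x..}|lebesgue. (weight a c t)\<^sup>2 * exp (- 2 * a * t)) \<le> (weight a c x)\<^sup>2 / (4 * a * c)"
    by (simp add: f_def)
qed

text \<open>The factor \<open>exp (a * t)\<close> goes to \<open>q\<close> and
  \<open>exp (- a * t)\<close> to the weight: the first product is square integrable by assumption,
  the second by \<open>weight_square_tail\<close>. Both contributions come out proportional to the
  weight at the lower endpoint.\<close>

lemma weighted_tail_integral_small: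
  fixes q :: "real \<Rightarrow> real"
  assumes a: "0 < a" and B: "0 < B" and q: "q \<in> borel_measurable lebesgue"
    and q2: "integrable lebesgue (\<lambda>t. (q t)\<^sup>2 * exp (2 * a * t))"
  obtains c where "0 < c"
    and "\<And>x. set_integrable lebesgue {x..} (\<lambda>t. \<bar>q t\<bar> * weight a c t)"
    and "\<And>x. B * (LINT t:{x..}|lebesgue. \<bar>q t\<bar> * weight a c t) \<le> weight a c x / 2"
proof -
  define N where "N = (LINT t|lebesgue. (q t)\<^sup>2 * exp (2 * a * t))"
  have N: "0 \<le> N" unfolding N_def by (rule integral_nonneg_AE) simp
  txt \<open>Young's inequality \<open>2uv \<le> s u\<^sup>2 + v\<^sup>2 / s\<close> with \<open>s = d * weight a c x\<close>; \<open>d\<close> makes the first term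
    small and then \<open>c\<close> the second.\<close>
  define d where "d = 1 / (2 * B * (N + 1))"
  have d: "0 < d" using B N by (simp add: d_def)
  define c where "c = B / (2 * a * d)"
  have c: "0 < c" using a B d by (simp add: c_def)
  let ?W = "weight a c"
  let ?Q = "\<lambda>t. (q t)\<^sup>2 * exp (2 * a * t)"
  let ?V = "\<lambda>t. (?W t)\<^sup>2 * exp (- 2 * a * t)"
  have W: "0 < ?W x" for x by (simp add: weight_def)
  have meas: "?W \<in> borel_measurable lebesgue"
    unfolding weight_def by (intro continuous_borel_measurable_lebesgue continuous_intros)
  have Qi: "set_integrable lebesgue {x..} ?Q" for x
    unfolding set_integrable_def using integrable_mult_indicator[OF _ q2] by simp
  have Vi: "set_integrable lebesgue {x..} ?V" for x
    by (rule weight_square_tail(1)[OF a c])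
  define G where "G x t = (d * ?W x) * ?Q t / 2 + ?V t / (2 * (d * ?W x))" for x t
  have Gi: "set_integrable lebesgue {x..} (G x)" for x
    unfolding G_def using Qi[of x] Vi[of x] by (intro set_integral_add) auto
  have GI: "(LINT t:{x..}|lebesgue. G x t) = (d * ?W x) / 2 * (LINT t:{x..}|lebesgue. ?Q t)
      + (LINT t:{x..}|lebesgue. ?V t) / (2 * (d * ?W x))" for x
  proof -
    have "set_integrable lebesgue {x..} (\<lambda>t. (d * ?W x) / 2 * ?Q t)"
         "set_integrable lebesgue {x..} (\<lambda>t. ?V t / (2 * (d * ?W x)))"
      using Qi[of x] Vi[of x] by auto
    from set_integral_add(2)[OF this] show ?thesis
      by (simp add: G_def)
  qed
  have le: "\<bar>q t\<bar> * ?W t \<le> G x t" for x t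
  proof -
    define s where "s = d * ?W x"
    have s: "0 < s" using d W[of x] by (simp add: s_def)
    define u where "u = \<bar>q t\<bar> * exp (a * t)"
    define v where "v = ?W t * exp (- a * t)"
    have uv: "\<bar>q t\<bar> * ?W t = u * v"
      by (simp add: u_def v_def mult_ac flip: exp_add)
    have "?Q t = u\<^sup>2" "?V t = v\<^sup>2"
      by (simp_all add: u_def v_def power_mult_distrib mult_ac flip: exp_double)
    then have "G x t = s * u\<^sup>2 / 2 + v\<^sup>2 / (2 * s)"
      by (simp add: G_def s_def)
    moreover have "s * u\<^sup>2 / 2 + v\<^sup>2 / (2 * s) - u * v = (s * u - v)\<^sup>2 / (2 * s)"
      using s by (simp add: field_simps power2_eq_square)
    moreover have "0 \<le> (s * u - v)\<^sup>2 / (2 * s)" using s by simp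
    ultimately show ?thesis using uv by linarith
  qed
  have qWi: "set_integrable lebesgue {x..} (\<lambda>t. \<bar>q t\<bar> * ?W t)" for x
  proof (rule set_integrable_bound[OF Gi])
    show "set_borel_measurable lebesgue {x..} (\<lambda>t. \<bar>q t\<bar> * ?W t)"
      unfolding set_borel_measurable_def
      using q meas by (intro borel_measurable_scaleR borel_measurable_indicator borel_measurable_times) auto
    show "AE t in lebesgue. t \<in> {x..} \<longrightarrow> norm (\<bar>q t\<bar> * ?W t) \<le> norm (G x t)"
      using le W by (intro AE_I2) (simp add: abs_mult less_imp_le, metis abs_ge_self order_trans)
  qed
  moreover have "B * (LINT t:{x..}|lebesgue. \<bar>q t\<bar> * ?W t) \<le> ?W x / 2" for x
  proof -
    have "(LINT t:{x..}|lebesgue. ?Q t) \<le> N"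
      unfolding N_def set_lebesgue_integral_def
      using Qi[of x] q2 by (intro integral_mono) (auto simp: set_integrable_def indicator_def)
    moreover have "(LINT t:{x..}|lebesgue. ?V t) \<le> (?W x)\<^sup>2 / (4 * a * c)"
      by (rule weight_square_tail(2)[OF a c])
    ultimately have "(LINT t:{x..}|lebesgue. G x t) \<le> (d * ?W x) / 2 * N + (?W x)\<^sup>2 / (4 * a * c) / (2 * (d * ?W x))"
      unfolding GI using d W[of x] by (intro add_mono mult_left_mono divide_right_mono) auto
    also have "\<dots> = ?W x * (d * N / 2 + 1 / (8 * a * c * d))"
      using d W[of x] a c by (simp add: field_simps power2_eq_square)
    \<comment> \<open>The choice of \<open>c\<close> makes the second coefficient
      \<open>1 / (4 * B)\<close>, and the choice of \<open>d\<close> bounds the first by the same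
      number. Using \<open>N + 1\<close> in \<open>d\<close> also covers
      \<open>N = 0\<close>.\<close>
    also have "8 * a * c * d = 4 * B"
      using a d by (simp add: c_def field_simps)
    also have "d * N / 2 \<le> 1 / (4 * B)"
    proof -
      have "d * N / 2 = N / (N + 1) * (1 / (4 * B))" by (simp add: d_def)
      also have "\<dots> \<le> 1 * (1 / (4 * B))" using B N by (intro mult_right_mono) auto
      finally show ?thesis by simp
    qed
    finally have "(LINT t:{x..}|lebesgue. G x t) \<le> ?W x * (1 / (2 * B))"
      using W[of x] by (simp add: mult_left_mono)
    moreover have "(LINT t:{x..}|lebesgue. \<bar>q t\<bar> * ?W t) \<le> (LINT t:{x..}|lebesgue. G x t)"
      by (intro set_integral_mono qWi Gi le)
    ultimately have "(LINT t:{x..}|lebesgue. \<bar>q t\<bar> * ?W t) \<le> ?W x * (1 / (2 * B))" by linarith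
    then show ?thesis using B by (simp add: field_simps)
  qed
  ultimately show ?thesis using c that by blast
qed

section \<open>The kernel of the integral equation\<close>

text \<open>A family closed under differentiation that contains the kernel, so one continuity lemma
  and one bound serve the kernel and both derivatives.\<close>

definition expsum :: "complex \<Rightarrow> complex \<Rightarrow> complex \<Rightarrow> complex \<Rightarrow> complex \<Rightarrow> real \<Rightarrow> complex" where
  "expsum w1 w2 c0 c1 c2 u = c0 + c1 * exp (w1 * complex_of_real u) + c2 * exp (w2 * complex_of_real u)"

lemma continuous_on_expsum: "continuous_on S (expsum w1 w2 c0 c1 c2)"
  unfolding expsum_def by (intro continuous_intros)

lemma norm_expsum_le:
  assumes "Re w1 \<le> 0" "Re w2 \<le> 0" "0 \<le> u"
  shows "norm (expsum w1 w2 c0 c1 c2 u) \<le> norm c0 + norm c1 + norm c2"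
proof -
  have "norm (c * exp (w * complex_of_real u)) \<le> norm c" if "Re w \<le> 0" for c w
    using that assms(3) by (simp add: norm_mult mult_left_le mult_nonpos_nonneg)
  from this[OF assms(1), of c1] this[OF assms(2), of c2] show ?thesis
    unfolding expsum_def by (intro norm_triangle_mono order_refl)
qed

lemma exp_scaled_has_vector_derivative:
  "((\<lambda>u. exp (w * complex_of_real u)) has_vector_derivative w * exp (w * complex_of_real u)) (at u)"
proof -
  have "((\<lambda>z. exp (w * z)) has_field_derivative w * exp (w * complex_of_real u)) (at (complex_of_real u))"
    by (auto intro!: derivative_eq_intros)
  from has_vector_derivative_real_field[OF this, of UNIV] show ?thesis by simp
qed

lemma expsum_has_vector_derivative:
  "(expsum w1 w2 c0 c1 c2 has_vector_derivative expsum w1 w2 0 (c1 * w1) (c2 * w2) u) (at u)"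
proof -
  have "(expsum w1 w2 c0 c1 c2 has_vector_derivative
      0 + c1 * (w1 * exp (w1 * complex_of_real u)) + c2 * (w2 * exp (w2 * complex_of_real u))) (at u)"
    unfolding expsum_def
    by (intro has_vector_derivative_add has_vector_derivative_const has_vector_derivative_mult_right
        exp_scaled_has_vector_derivative)
  then show ?thesis by (simp add: expsum_def mult_ac)
qed

text \<open>Holds because \<open>zeta1\<close> is a cube root of unity.\<close>

lemma zeta1_powi: "zeta1 powi (-2) = zeta1"
proof -
  have "zeta1 * zeta1\<^sup>2 = 1"
    by (simp add: zeta1_def complex_eq_iff power2_eq_square field_simps)
  then have "inverse (zeta1\<^sup>2) = zeta1" by (metis inverse_unique mult.commute)
  then show ?thesis by (simp add: power_int_minus)
qed

lemma zeta2_powi: "zeta2 powi (-2) = zeta2"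
proof -
  have "zeta2 * zeta2\<^sup>2 = 1"
    by (simp add: zeta2_def complex_eq_iff power2_eq_square field_simps)
  then have "inverse (zeta2\<^sup>2) = zeta2" by (metis inverse_unique mult.commute)
  then show ?thesis by (simp add: power_int_minus)
qed

text \<open>The sums of the roots and of their squares are what make the kernel and its derivative
  vanish at \<open>0\<close>.\<close>

lemma zeta_sum: "1 + zeta1 + zeta2 = 0"
  by (simp add: zeta1_def zeta2_def field_simps)

lemma zeta_square_sum: "1 + zeta1\<^sup>2 + zeta2\<^sup>2 = 0"
  by (simp add: zeta1_def zeta2_def complex_eq_iff power2_eq_square field_simps)

text \<open>The prefactor shifts each exponent of \<open>s2\<close> to a multiple of one minus the
  root. For \<open>zeta0\<close> the exponent becomes \<open>0\<close>, which gives the constant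
  term.\<close>

lemma jost_kernel_expsum:
  "- \<i> * z * (exp (\<i> * z * complex_of_real u) * s2 (\<i> * z * complex_of_real (- u)))
     = expsum (\<i> * z * (1 - zeta1)) (\<i> * z * (1 - zeta2))
         (- \<i> * z / 3) (- \<i> * z / 3 * zeta1) (- \<i> * z / 3 * zeta2) u"
proof -
  have e: "exp (\<i> * z * complex_of_real u) * exp (w * (\<i> * z * complex_of_real (- u)))
      = exp (\<i> * z * (1 - w) * complex_of_real u)" for w
    by (simp add: algebra_simps flip: exp_add)
  have "exp (\<i> * z * complex_of_real u) * s2 (\<i> * z * complex_of_real (- u))
      = 1/3 * (exp (\<i> * z * complex_of_real u) * exp (zeta0 * (\<i> * z * complex_of_real (- u)))
        + zeta1 * (exp (\<i> * z * complex_of_real u) * exp (zeta1 * (\<i> * z * complex_of_real (- u))))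
        + zeta2 * (exp (\<i> * z * complex_of_real u) * exp (zeta2 * (\<i> * z * complex_of_real (- u)))))"
    unfolding s2_def zeta1_powi zeta2_powi by (simp add: algebra_simps)
  then show ?thesis
    unfolding e by (simp add: expsum_def zeta0_def algebra_simps)
qed

text \<open>The real parts are \<open>- n * \<beta>\<close>,
  \<open>n / 2 * (sqrt 3 * \<alpha> - 3 * \<beta>)\<close> and
  \<open>n / 2 * (- (sqrt 3 * \<alpha>) - 3 * \<beta>)\<close>. The sector inequality forces
  \<open>0 < \<beta>\<close> and, multiplied by \<open>sqrt 3\<close>, settles the other
  two.\<close>

lemma Omega0_exponents:
  assumes "lam \<in> Omega0" "0 < n"
  shows "Re (\<i> * (lam * complex_of_real n)) < 0"
    and "Re (\<i> * (lam * complex_of_real n) * (1 - zeta1)) \<le> 0"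
    and "Re (\<i> * (lam * complex_of_real n) * (1 - zeta2)) \<le> 0"
proof -
  obtain \<alpha> \<beta> where lam: "lam = Complex \<alpha> \<beta>" and ab: "\<bar>\<alpha>\<bar> < sqrt 3 * \<beta>"
    using assms(1) by (auto simp: Omega0_def)
  have "0 < sqrt 3 * \<beta>" using ab by linarith
  then have "0 < \<beta>" by (simp add: zero_less_mult_iff)
  then show "Re (\<i> * (lam * complex_of_real n)) < 0"
    using assms(2) by (simp add: lam)
  have m: "sqrt 3 * \<bar>\<alpha>\<bar> \<le> 3 * \<beta>"
    using mult_left_mono[OF less_imp_le[OF ab], of "sqrt 3"] by (simp flip: mult.assoc)
  have "sqrt 3 * \<alpha> \<le> sqrt 3 * \<bar>\<alpha>\<bar>" "sqrt 3 * (- \<alpha>) \<le> sqrt 3 * \<bar>\<alpha>\<bar>"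
    by (intro mult_left_mono; simp)+
  with m have "sqrt 3 * \<alpha> - 3 * \<beta> \<le> 0" "- (sqrt 3 * \<alpha>) - 3 * \<beta> \<le> 0" by linarith+
  then have "n / 2 * (sqrt 3 * \<alpha> - 3 * \<beta>) \<le> 0" "n / 2 * (- (sqrt 3 * \<alpha>) - 3 * \<beta>) \<le> 0"
    using assms(2) by (simp_all add: mult_nonneg_nonpos)
  then show "Re (\<i> * (lam * complex_of_real n) * (1 - zeta1)) \<le> 0"
    and "Re (\<i> * (lam * complex_of_real n) * (1 - zeta2)) \<le> 0"
    by (simp_all add: lam zeta1_def zeta2_def field_simps)
qed

section \<open>Square integrability of the Jost solution\<close>

lemma set_integrable_exp_atLeast:
  fixes b y :: real
  assumes "0 < b"
  shows "set_integrable lebesgue {y..} (\<lambda>x. exp (- b * x))"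
  by (intro nonnegative_absolutely_integrable_1 integrable_on_exp_minus_to_infinity assms) auto

text \<open>The squared norm is dominated on the half-line by
  \<open>C\<^sup>2 * exp (2 * Re w * x)\<close>, and continuity supplies measurability.\<close>

lemma in_L2_Rplus_exp_decay:
  fixes p :: "real \<Rightarrow> complex"
  assumes p: "continuous_on UNIV p" and pC: "\<And>x. 0 \<le> x \<Longrightarrow> norm (p x) \<le> C" and w: "Re w < 0"
  shows "in_L2_Rplus (\<lambda>x. exp (w * complex_of_real x) * p x)"
  unfolding in_L2_Rplus_def
proof
  let ?f = "\<lambda>x. exp (w * complex_of_real x) * p x"
  have f: "continuous_on UNIV ?f" using p by (intro continuous_intros)
  have fm: "?f \<in> borel_measurable lebesgue" "(\<lambda>x. (norm (?f x))\<^sup>2) \<in> borel_measurable lebesgue"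
    by (rule continuous_borel_measurable_lebesgue, rule f)
      (intro continuous_borel_measurable_lebesgue continuous_on_power continuous_on_norm f)
  show "set_borel_measurable lebesgue {0..} ?f"
    unfolding set_borel_measurable_def using fm
    by (intro borel_measurable_scaleR borel_measurable_indicator) auto
  have "0 < - (2 * Re w)" using w by simp
  from set_integrable_exp_atLeast[OF this, of 0]
  have "set_integrable lebesgue {0..} (\<lambda>x. C\<^sup>2 * exp (2 * Re w * x))" by simp
  then show "set_integrable lebesgue {0..} (\<lambda>x. (norm (?f x))\<^sup>2)"
  proof (rule set_integrable_bound)
    show "set_borel_measurable lebesgue {0..} (\<lambda>x. (norm (?f x))\<^sup>2)"
      unfolding set_borel_measurable_def using fm
      by (intro borel_measurable_scaleR borel_measurable_indicator) auto
    show "AE x in lebesgue. x \<in> {0..} \<longrightarrow> norm ((norm (?f x))\<^sup>2) \<le> norm (C\<^sup>2 * exp (2 * Re w * x))"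
    proof (intro AE_I2 impI)
      fix x :: real assume "x \<in> {0..}"
      then have "(norm (p x))\<^sup>2 \<le> C\<^sup>2" using pC by (intro power_mono) auto
      moreover have "(norm (?f x))\<^sup>2 = (norm (p x))\<^sup>2 * exp (2 * Re w * x)"
        by (simp add: norm_mult power_mult_distrib mult_ac flip: exp_double)
      ultimately show "norm ((norm (?f x))\<^sup>2) \<le> norm (C\<^sup>2 * exp (2 * Re w * x))"
        by (simp add: abs_mult mult_right_mono)
    qed
  qed
qed

text \<open>Reflection of the decay at plus infinity. The affine substitution is stated for
  \<open>lborel\<close>, so the Borel integrand passes there and back through the
  completion.\<close>

lemma set_integrable_exp_atMost:
  fixes b y :: real
  assumes "0 < b"
  shows "set_integrable lebesgue {..y} (\<lambda>x. exp (b * x))"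
proof -
  let ?f = "\<lambda>x. indicator {-y..} x *\<^sub>R exp (- b * x)"
  have "?f \<in> borel_measurable lborel"
    by measurable
  moreover have "integrable lebesgue ?f"
    using set_integrable_exp_atLeast[OF assms] unfolding set_integrable_def .
  ultimately have "integrable lborel ?f"
    by (simp add: integrable_completion)
  from lborel_integrable_real_affine[OF this, of "-1" 0]
  have "integrable lborel (\<lambda>x. indicator {..y} x *\<^sub>R exp (b * x))"
    by (rule Bochner_Integration.integrable_cong[THEN iffD1, rotated 2]) (auto simp: indicator_def)
  moreover have "(\<lambda>x. indicator {..y} x *\<^sub>R exp (b * x)) \<in> borel_measurable lborel"
    by measurable
  ultimately show ?thesis
    unfolding set_integrable_def by (simp add: integrable_completion)
qed

text \<open>To the right this is the decay assumption up to the factor \<open>mp\<^sup>2\<close>. To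
  the left \<open>m\<close> tends to \<open>mm\<close> instead in the mean-square sense, but there
  \<open>exp (2 * a * t)\<close> itself decays, so the constant \<open>mm - mp\<close> contributes
  an integrable term.\<close>

lemma relative_coefficient_square_integrable:
  fixes m :: "real \<Rightarrow> real"
  assumes m: "m \<in> borel_measurable lebesgue" and mp: "0 < mp" and a: "0 < a"
    and plus: "set_integrable lebesgue {0..} (\<lambda>x. \<bar>m x - mp\<bar>\<^sup>2 * exp (2 * a * \<bar>x\<bar>))"
    and minus: "set_integrable lebesgue {..0} (\<lambda>x. \<bar>m x - mm\<bar>\<^sup>2 * exp (2 * a * \<bar>x\<bar>))"
  shows "integrable lebesgue (\<lambda>t. (m t / mp - 1)\<^sup>2 * exp (2 * a * t))"
proof -
  let ?g = "\<lambda>t. (m t / mp - 1)\<^sup>2 * exp (2 * a * t)"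
  have ex: "(\<lambda>t. exp (2 * a * t)) \<in> borel_measurable lebesgue"
    by (intro continuous_borel_measurable_lebesgue continuous_intros)
  have gm: "?g \<in> borel_measurable lebesgue"
    using m ex by measurable
  have eq: "?g t = \<bar>m t - mp\<bar>\<^sup>2 * exp (2 * a * t) / mp\<^sup>2" for t
    using mp by (simp add: power2_eq_square field_simps)
  have "set_integrable lebesgue {0..} ?g"
    unfolding eq using plus
    by (subst set_integrable_cong[OF refl refl, where f' = "\<lambda>x. \<bar>m x - mp\<bar>\<^sup>2 * exp (2 * a * \<bar>x\<bar>) / mp\<^sup>2"]) auto
  moreover have "set_integrable lebesgue {..0} ?g"
  proof (rule set_integrable_bound)
    show "set_integrable lebesgue {..0} (\<lambda>x. 2 / mp\<^sup>2 * (\<bar>m x - mm\<bar>\<^sup>2 * exp (2 * a * \<bar>x\<bar>))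
        + 2 / mp\<^sup>2 * (mm - mp)\<^sup>2 * exp (2 * a * x))"
      using minus set_integrable_exp_atMost[of "2 * a" 0] a by (intro set_integral_add) auto
    show "set_borel_measurable lebesgue {..0} ?g"
      unfolding set_borel_measurable_def using gm
      by (intro borel_measurable_scaleR borel_measurable_indicator) auto
    show "AE t in lebesgue. t \<in> {..0} \<longrightarrow> norm (?g t) \<le> norm (2 / mp\<^sup>2 * (\<bar>m t - mm\<bar>\<^sup>2 * exp (2 * a * \<bar>t\<bar>))
        + 2 / mp\<^sup>2 * (mm - mp)\<^sup>2 * exp (2 * a * t))"
    proof (intro AE_I2 impI)
      fix t :: real assume t: "t \<in> {..0}"
      have "(m t - mp)\<^sup>2 \<le> 2 * \<bar>m t - mm\<bar>\<^sup>2 + 2 * (mm - mp)\<^sup>2"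
        using zero_le_power2[of "(m t - mm) - (mm - mp)"] by (simp add: power2_eq_square algebra_simps)
      then have "(m t - mp)\<^sup>2 * exp (2 * a * t) \<le> (2 * \<bar>m t - mm\<bar>\<^sup>2 + 2 * (mm - mp)\<^sup>2) * exp (2 * a * t)"
        by (rule mult_right_mono) simp
      also have "\<dots> \<le> 2 * (\<bar>m t - mm\<bar>\<^sup>2 * exp (2 * a * \<bar>t\<bar>)) + 2 * (mm - mp)\<^sup>2 * exp (2 * a * t)"
      proof -
        have "\<bar>m t - mm\<bar>\<^sup>2 * exp (2 * a * t) \<le> \<bar>m t - mm\<bar>\<^sup>2 * exp (2 * a * \<bar>t\<bar>)"
          using a by (intro mult_left_mono) (auto intro: mult_left_mono)
        then show ?thesis by (simp add: algebra_simps)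
      qed
      finally have "(m t - mp)\<^sup>2 * exp (2 * a * t) / mp\<^sup>2
          \<le> (2 * (\<bar>m t - mm\<bar>\<^sup>2 * exp (2 * a * \<bar>t\<bar>)) + 2 * (mm - mp)\<^sup>2 * exp (2 * a * t)) / mp\<^sup>2"
        by (rule divide_right_mono) simp
      then show "norm (?g t) \<le> norm (2 / mp\<^sup>2 * (\<bar>m t - mm\<bar>\<^sup>2 * exp (2 * a * \<bar>t\<bar>))
        + 2 / mp\<^sup>2 * (mm - mp)\<^sup>2 * exp (2 * a * t))"
        unfolding eq by (simp add: add_divide_distrib)
    qed
  qed
  ultimately have "set_integrable lebesgue ({0..} \<union> {..0}) ?g"
    by (rule set_integrable_Un) auto
  moreover have "{0..} \<union> {..0} = (UNIV :: real set)" by auto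
  ultimately show ?thesis by (simp add: set_integrable_def)
qed

text \<open>Differentiability at every point is part of the conclusion so that both applications of
  \<open>ddx\<close> are genuine derivatives and not arbitrary values of
  \<open>vector_derivative\<close>.\<close>

theorem theorem1p3:
  fixes m :: "real \<Rightarrow> real" and mp mm a :: real
  assumes m_meas: "m \<in> borel_measurable lebesgue"
    and m_plus: "(m \<longlongrightarrow> mp) at_top" "0 < mp"
    and m_minus: "(m \<longlongrightarrow> mm) at_bot" "0 < mm"
    and a_pos: "0 < a"
    and decay_plus: "set_integrable lebesgue {0..} (\<lambda>x. \<bar>m x - mp\<bar>\<^sup>2 * exp (2 * a * \<bar>x\<bar>))"
    and decay_minus: "set_integrable lebesgue {..0} (\<lambda>x. \<bar>m x - mm\<bar>\<^sup>2 * exp (2 * a * \<bar>x\<bar>))"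
  shows "\<forall>lam \<in> Omega0.
           (\<forall>x. jost_v m mp lam differentiable (at x)) \<and>
           (\<forall>x. ddx (jost_v m mp lam) differentiable (at x)) \<and>
           in_L2_Rplus (jost_v m mp lam) \<and>
           in_L2_Rplus (ddx (jost_v m mp lam)) \<and>
           in_L2_Rplus (ddx (ddx (jost_v m mp lam)))"
proof
  fix lam assume lam: "lam \<in> Omega0"
  define z where "z = z_plus mp lam"
  define w where "w = \<i> * z"
  define w1 where "w1 = w * (1 - zeta1)"
  define w2 where "w2 = w * (1 - zeta2)"
  have "0 < n_plus mp" using m_plus by (simp add: n_plus_def)
  from Omega0_exponents[OF lam this]
  have w: "Re w < 0" and w12: "Re w1 \<le> 0" "Re w2 \<le> 0"
    by (simp_all only: w_def w1_def w2_def z_def z_plus_def)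
  define c where "c = - w / 3"
  define k where "k = expsum w1 w2 c (c * zeta1) (c * zeta2)"
  define k1 where "k1 = expsum w1 w2 0 (c * zeta1 * w1) (c * zeta2 * w2)"
  define k2 where "k2 = expsum w1 w2 0 (c * zeta1 * w1 * w1) (c * zeta2 * w2 * w2)"
  \<comment> \<open>Each of the two differentiations under the integral consumes one of these
    zeros.\<close>
  have k0: "k 0 = 0" and k10: "k1 0 = 0"
  proof -
    have "k 0 = c * (1 + zeta1 + zeta2)" by (simp add: k_def expsum_def algebra_simps)
    then show "k 0 = 0" by (simp only: zeta_sum mult_zero_right)
    have "k1 0 = c * w * ((1 + zeta1 + zeta2) - (1 + zeta1\<^sup>2 + zeta2\<^sup>2))"
      by (simp add: k1_def expsum_def w1_def w2_def algebra_simps power2_eq_square)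
    then show "k1 0 = 0" by (simp only: zeta_sum zeta_square_sum diff_self mult_zero_right)
  qed
  have dk: "(k has_vector_derivative k1 u) (at u)" and dk1: "(k1 has_vector_derivative k2 u) (at u)" for u
    unfolding k_def k1_def k2_def by (auto intro: expsum_has_vector_derivative)
  have kc: "continuous_on UNIV k" "continuous_on UNIV k1" "continuous_on UNIV k2"
    unfolding k_def k1_def k2_def by (rule continuous_on_expsum)+
  \<comment> \<open>The summand \<open>1\<close> guarantees \<open>0 < B\<close>; the choice of the
    weight divides by \<open>B\<close>.\<close>
  define B where "B = 1 + norm c + norm (c * zeta1) + norm (c * zeta2)"
  obtain B1 B2 where B1: "\<And>u. 0 \<le> u \<Longrightarrow> norm (k1 u) \<le> B1" and B2: "\<And>u. 0 \<le> u \<Longrightarrow> norm (k2 u) \<le> B2"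
    unfolding k1_def k2_def using norm_expsum_le[OF w12] by metis
  have kB: "norm (k u) \<le> B" if "0 \<le> u" for u
    unfolding k_def B_def using norm_expsum_le[OF w12 that, of c "c * zeta1" "c * zeta2"] by linarith
  have "0 < B" unfolding B_def by (intro add_pos_nonneg) auto
  define q where "q t = m t / mp - 1" for t
  have qm: "q \<in> borel_measurable lebesgue"
    unfolding q_def using m_meas by measurable
  have "integrable lebesgue (\<lambda>t. (q t)\<^sup>2 * exp (2 * a * t))"
    unfolding q_def
    by (rule relative_coefficient_square_integrable[OF m_meas m_plus(2) a_pos decay_plus decay_minus])
  from weighted_tail_integral_small[OF a_pos \<open>0 < B\<close> qm this]
  obtain r where r: "0 < r"
    and qW: "\<And>x. set_integrable lebesgue {x..} (\<lambda>t. \<bar>q t\<bar> * weight a r t)"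
      "\<And>x. B * (LINT t:{x..}|lebesgue. \<bar>q t\<bar> * weight a r t) \<le> weight a r x / 2"
    by metis
  interpret volterra_contraction k "\<lambda>t. complex_of_real (q t)" "weight a r" B
  proof
    show "(\<lambda>t. complex_of_real (q t)) \<in> borel_measurable lebesgue" using qm by measurable
  qed (use kc kB qW r weight_ge_1 in auto)
  \<comment> \<open>The integrands agree up to the constant factor for every \<open>f\<close>,
    integrable or not, so the operators, their iterates and the two series coincide.\<close>
  have "jost_op m mp lam = T"
  proof (intro ext)
    fix f x
    have "k (t - x) = - \<i> * z * (exp (\<i> * z * complex_of_real (t - x)) * s2 (\<i> * z * complex_of_real (x - t)))" for t
      using jost_kernel_expsum[of z "t - x"] unfolding k_def w1_def w2_def c_def w_def by simp
    then have "T f x = (LINT t:{x..}|lebesgue. (- \<i> * z) * (exp (\<i> * z * complex_of_real (t - x))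
          * s2 (\<i> * z * complex_of_real (x - t)) * complex_of_real (m t / mp - 1) * f t))"
      unfolding T_def tail_conv_def unfolding q_def by (simp only: mult.assoc)
    then show "jost_op m mp lam f x = T f x"
      by (simp only: jost_op_def z_def set_integral_mult_right)
  qed
  then have psi: "jost_psi m mp lam = neumann"
    by (intro ext) (simp only: jost_psi_def neumann_def iter_def)
  define g where "g = (\<lambda>t. complex_of_real (q t) * neumann t)"
  have g: "set_integrable lebesgue {x..} g" for x
    unfolding g_def by (rule q_integrable[OF neumann_bounded_by])
  \<comment> \<open>By \<open>neumann_eq\<close> the solution is \<open>1 + p\<close>. Each
    differentiation in \<open>x\<close> brings a factor \<open>-1\<close>, so \<open>p1\<close>
    carries a sign and \<open>p2\<close> does not.\<close>
  define p where "p = tail_conv k g"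
  define p1 where "p1 = (\<lambda>x. - tail_conv k1 g x)"
  define p2 where "p2 = tail_conv k2 g"
  have dp: "(p has_vector_derivative p1 x) (at x)" for x
    unfolding p_def p1_def by (rule tail_conv_has_vector_derivative[OF dk B1 kc(2) kB k0 g])
  have dp1: "(p1 has_vector_derivative p2 x) (at x)" for x
    using has_vector_derivative_minus[OF tail_conv_has_vector_derivative[OF dk1 B2 kc(3) B1 k10 g, of x]]
    by (simp add: p1_def p2_def)
  have pc: "continuous_on UNIV p" "continuous_on UNIV p1" "continuous_on UNIV p2"
    unfolding p_def p1_def p2_def
    using continuous_on_tail_conv[OF kc(1) kB g] continuous_on_tail_conv[OF kc(2) B1 g]
      continuous_on_tail_conv[OF kc(3) B2 g]
    by (auto intro: continuous_on_minus)
  obtain C C1 C2 where C: "\<And>x. 0 \<le> x \<Longrightarrow> norm (p x) \<le> C"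
    and C1: "\<And>x. 0 \<le> x \<Longrightarrow> norm (p1 x) \<le> C1" and C2: "\<And>x. 0 \<le> x \<Longrightarrow> norm (p2 x) \<le> C2"
    using norm_tail_conv_bounded[OF kc(1) kB g] norm_tail_conv_bounded[OF kc(2) B1 g]
      norm_tail_conv_bounded[OF kc(3) B2 g]
    unfolding p_def p1_def p2_def norm_minus_cancel by metis
  let ?E = "\<lambda>x. exp (w * complex_of_real x)"
  have v: "jost_v m mp lam = (\<lambda>x. ?E x * (1 + p x))"
  proof
    fix x show "jost_v m mp lam x = ?E x * (1 + p x)"
      using neumann_eq[of x] unfolding jost_v_def psi by (simp add: T_def p_def g_def w_def z_def)
  qed
  have dv: "((\<lambda>x. ?E x * (1 + p x)) has_vector_derivative ?E x * (w * (1 + p x) + p1 x)) (at x)" for x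
  proof -
    have "((\<lambda>x. ?E x * (1 + p x)) has_vector_derivative
        ?E x * (0 + p1 x) + (w * ?E x) * (1 + p x)) (at x)"
      by (intro has_vector_derivative_mult exp_scaled_has_vector_derivative has_vector_derivative_add
          has_vector_derivative_const dp)
    then show ?thesis by (simp add: algebra_simps)
  qed
  have dv1: "((\<lambda>x. ?E x * (w * (1 + p x) + p1 x)) has_vector_derivative
      ?E x * (w\<^sup>2 * (1 + p x) + 2 * w * p1 x + p2 x)) (at x)" for x
  proof -
    have "((\<lambda>x. ?E x * (w * (1 + p x) + p1 x)) has_vector_derivative
        ?E x * (w * (0 + p1 x) + p2 x) + (w * ?E x) * (w * (1 + p x) + p1 x)) (at x)"
      by (intro has_vector_derivative_mult exp_scaled_has_vector_derivative has_vector_derivative_add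
          has_vector_derivative_mult_right has_vector_derivative_const dp dp1)
    then show ?thesis by (simp add: algebra_simps power2_eq_square)
  qed
  have v1: "ddx (jost_v m mp lam) = (\<lambda>x. ?E x * (w * (1 + p x) + p1 x))"
    unfolding v ddx_def using dv by (intro ext vector_derivative_at)
  have v2: "ddx (ddx (jost_v m mp lam)) = (\<lambda>x. ?E x * (w\<^sup>2 * (1 + p x) + 2 * w * p1 x + p2 x))"
    unfolding v1 unfolding ddx_def using dv1 by (intro ext vector_derivative_at)
  have "jost_v m mp lam differentiable (at x)" for x
    unfolding v by (rule differentiableI_vector[OF dv])
  moreover have "ddx (jost_v m mp lam) differentiable (at x)" for x
    unfolding v1 by (rule differentiableI_vector[OF dv1])
  \<comment> \<open>In all three membership claims the cofactor of \<open>?E x\<close> is continuous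
    and bounded on the half-line through \<open>C\<close>, \<open>C1\<close> and
    \<open>C2\<close>.\<close>
  moreover have "in_L2_Rplus (jost_v m mp lam)"
    unfolding v
  proof (rule in_L2_Rplus_exp_decay[OF _ _ w])
    show "continuous_on UNIV (\<lambda>x. 1 + p x)" using pc by (intro continuous_intros)
    show "norm (1 + p x) \<le> 1 + C" if "0 \<le> x" for x
      using C[OF that] by (intro norm_triangle_mono) auto
  qed
  moreover have "in_L2_Rplus (ddx (jost_v m mp lam))"
    unfolding v1
  proof (rule in_L2_Rplus_exp_decay[OF _ _ w])
    show "continuous_on UNIV (\<lambda>x. w * (1 + p x) + p1 x)" using pc by (intro continuous_intros)
    show "norm (w * (1 + p x) + p1 x) \<le> norm w * (1 + C) + C1" if "0 \<le> x" for x
      using C[OF that] C1[OF that] unfolding norm_mult[symmetric]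
      by (intro norm_triangle_mono) (auto simp: norm_mult intro!: mult_left_mono norm_triangle_mono)
  qed
  moreover have "in_L2_Rplus (ddx (ddx (jost_v m mp lam)))"
    unfolding v2
  proof (rule in_L2_Rplus_exp_decay[OF _ _ w])
    show "continuous_on UNIV (\<lambda>x. w\<^sup>2 * (1 + p x) + 2 * w * p1 x + p2 x)" using pc by (intro continuous_intros)
    show "norm (w\<^sup>2 * (1 + p x) + 2 * w * p1 x + p2 x) \<le> norm (w\<^sup>2) * (1 + C) + norm (2 * w) * C1 + C2"
      if "0 \<le> x" for x
      using C[OF that] C1[OF that] C2[OF that]
      by (intro norm_triangle_mono)
        (auto simp: norm_mult norm_power intro!: mult_left_mono norm_triangle_mono)
  qed
  ultimately show "(\<forall>x. jost_v m mp lam differentiable (at x)) \<and>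
           (\<forall>x. ddx (jost_v m mp lam) differentiable (at x)) \<and>
           in_L2_Rplus (jost_v m mp lam) \<and>
           in_L2_Rplus (ddx (jost_v m mp lam)) \<and>
           in_L2_Rplus (ddx (ddx (jost_v m mp lam)))"
    by blast
qed

end
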